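(* Let $F_0$ be the distribution function defined in the context. Then $$\int_{-\infty}^\infty x\,dF_0(x)=0.$$
   Context: Let $u$ be the unique (global, real) solution on $\mathbb{R}$ of the Painlevé II equation $u''=2u^3+xu$ with $u(x)\sim-\mathrm{Ai}(x)$ as $x\to+\infty$, where $\mathrm{Ai}$ is the Airy function. Put $v(x)=\int_\infty^x u(s)^2ds=-\int_x^\infty u(s)^2ds$, $E(x)=\exp\bigl(\frac12\int_x^\infty u(s)ds\bigr)$, $F_{GUE}(x)=\exp\bigl(\int_x^\infty v(s)ds\bigr)=\exp\bigl(-\int_x^\infty(s-x)u(s)^2ds\bigr)$, and $$F_0(x)=\bigl\{1-(x+2u'(x)+2u(x)^2)v(x)\bigr\}E(x)^4F_{GUE}(x).$$ $F_0$ is a probability distribution function on $\mathbb{R}$ (nondecreasing, with limits $0$ at $-\infty$ and $1$ at $+\infty$). The known asymptotics of $u$ are $u(x)=-\mathrm{Ai}(x)+O(e^{-(4/3)x^{3/2}}x^{-1/4})$ as $x\to+\infty$ and $u(x)=-\sqrt{-x/2}\,(1+O(x^{-2}))$ as $x\to-\infty$. *)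

theory Defs
  imports "HOL-Analysis.Analysis" "HOL-Library.Landau_Symbols"
begin

section \<open>Lebesgue--Stieltjes integrals\<close>

text \<open>
  The constant \<^const>\<open>interval_measure\<close> is only meaningful for nondecreasing right-continuous
  integrators. The integral against a right-continuous function of locally bounded variation is
  obtained as usual by writing the integrator as a difference of two nondecreasing ones.
  Absolute convergence is part of the definition. The lemmas
  \<open>has_stieltjes_integral_mono_iff\<close> and \<open>has_stieltjes_integral_unique\<close> below show that for a
  nondecreasing integrator (e.g. a distribution function) this is exactly the integral with respect
  to \<^const>\<open>interval_measure\<close>, and that the value is independent of the decomposition.
\<close>

definition has_stieltjes_integral :: "(real \<Rightarrow> real) \<Rightarrow> (real \<Rightarrow> real) \<Rightarrow> real \<Rightarrow> bool" where
  "has_stieltjes_integral f F I \<longleftrightarrow>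
     (\<exists>G H a b. mono G \<and> mono H \<and>
        (\<forall>x. continuous (at_right x) G) \<and> (\<forall>x. continuous (at_right x) H) \<and>
        (\<forall>x. F x = G x - H x) \<and>
        has_bochner_integral (interval_measure G) f a \<and>
        has_bochner_integral (interval_measure H) f b \<and>
        I = a - b)"

lemma UN_symmetric_Ioc: "(\<Union>i. {- real (i::nat)<..real i}) = UNIV"
proof -
  have "\<exists>i::nat. - real i < x \<and> x \<le> real i" for x
  proof -
    obtain i :: nat where "\<bar>x\<bar> < real i" using reals_Archimedean2 by blast
    then show ?thesis by (intro exI[of _ i]) auto
  qed
  then show ?thesis by auto
qed

lemma emeasure_interval_measure_add:
  fixes G H :: "real \<Rightarrow> real"
  assumes G: "mono G" "\<And>x. continuous (at_right x) G"
    and H: "mono H" "\<And>x. continuous (at_right x) H"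
    and A: "A \<in> sets borel"
  shows "emeasure (interval_measure (\<lambda>x. G x + H x)) A =
           emeasure (interval_measure G) A + emeasure (interval_measure H) A"
proof -
  let ?\<mu> = "\<lambda>A. emeasure (interval_measure G) A + emeasure (interval_measure H) A"
  define N where "N = measure_of UNIV (sets (borel :: real measure)) ?\<mu>"
  have setsN: "sets N = sets borel"
    unfolding N_def using sets.sigma_sets_eq[of "borel :: real measure"] by simp
  have emN: "emeasure N A = ?\<mu> A" if "A \<in> sets borel" for A
  proof (rule emeasure_measure_of[OF N_def])
    show "countably_additive (sets N) ?\<mu>"
    proof (rule countably_additiveI)
      fix B :: "nat \<Rightarrow> real set"
      assume B: "range B \<subseteq> sets N" "disjoint_family B"
      have "(\<Sum>i. ?\<mu> (B i)) =
          (\<Sum>i. emeasure (interval_measure G) (B i)) + (\<Sum>i. emeasure (interval_measure H) (B i))"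
        by (simp add: suminf_add)
      also have "\<dots> = ?\<mu> (\<Union>i. B i)"
        using B by (simp add: suminf_emeasure setsN)
      finally show "(\<Sum>i. ?\<mu> (B i)) = ?\<mu> (\<Union>i. B i)" .
    qed
  qed (use that in \<open>auto simp: setsN positive_def\<close>)
  have mono: "G x \<le> G y" "H x \<le> H y" if "x \<le> y" for x y
    using G(1) H(1) that by (auto dest: monoD)
  have Ioc: "emeasure (interval_measure (\<lambda>x. G x + H x)) {a<..b} = ?\<mu> {a<..b}" for a b
  proof (cases "a \<le> b")
    case True
    then show ?thesis
      using mono[OF True] G(2) H(2)
      by (simp add: emeasure_interval_measure_Ioc mono add_mono continuous_intros
          flip: ennreal_plus)
  qed auto
  have "interval_measure (\<lambda>x. G x + H x) = N"
  proof (rule measure_eqI_generator_eq[where \<Omega>=UNIV])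
    show "(\<Union>i. {- real (i::nat)<..real i}) = UNIV"
      by (rule UN_symmetric_Ioc)
    fix X assume "X \<in> range (\<lambda>(a, b). {a<..b::real})"
    then show "emeasure (interval_measure (\<lambda>x. G x + H x)) X = emeasure N X"
      by (auto simp: Ioc emN)
  next
    show "emeasure (interval_measure (\<lambda>x. G x + H x)) {- real i<..real i} \<noteq> \<infinity>" for i :: nat
      using G(2) H(2)
      by (simp add: emeasure_interval_measure_Ioc mono add_mono continuous_intros)
  qed (auto simp: setsN borel_sigma_sets_Ioc Int_stable_def)
  with emN[OF A] show ?thesis by simp
qed

lemma nn_integral_interval_measure_add:
  fixes G H :: "real \<Rightarrow> real"
  assumes G: "mono G" "\<And>x. continuous (at_right x) G"
    and H: "mono H" "\<And>x. continuous (at_right x) H"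
    and f: "f \<in> borel_measurable borel"
  shows "(\<integral>\<^sup>+x. f x \<partial>interval_measure (\<lambda>x. G x + H x)) =
           (\<integral>\<^sup>+x. f x \<partial>interval_measure G) + (\<integral>\<^sup>+x. f x \<partial>interval_measure H)"
  using f
proof (induct rule: borel_measurable_induct)
  case (cong f g)
  then have "f = g" by auto
  with cong show ?case by simp
next
  case (set A)
  then show ?case by (simp add: emeasure_interval_measure_add[OF assms(1-4)])
next
  case (mult u c)
  then show ?case by (simp add: nn_integral_cmult distrib_left)
next
  case (add u v)
  then show ?case by (simp add: nn_integral_add ac_simps)
next
  case (seq U)
  note [measurable] = seq(1)
  have mc: "(\<integral>\<^sup>+x. (SUP i. U i) x \<partial>interval_measure K) = (SUP i. \<integral>\<^sup>+x. U i x \<partial>interval_measure K)"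
    for K
    using seq by (simp add: nn_integral_monotone_convergence_SUP image_comp)
  have inc: "incseq (\<lambda>i. \<integral>\<^sup>+x. U i x \<partial>interval_measure K)" for K
    using seq(4) by (auto simp: incseq_def le_fun_def intro!: nn_integral_mono)
  show ?case
    by (simp only: mc seq(3) ennreal_SUP_add[OF inc inc, symmetric])
qed

lemma has_bochner_integral_interval_measure_add:
  fixes G H f :: "real \<Rightarrow> real"
  assumes G: "mono G" "\<And>x. continuous (at_right x) G"
    and H: "mono H" "\<And>x. continuous (at_right x) H"
  shows "integrable (interval_measure (\<lambda>x. G x + H x)) f \<longleftrightarrow>
           integrable (interval_measure G) f \<and> integrable (interval_measure H) f" (is ?th1)
    and "has_bochner_integral (interval_measure G) f a \<Longrightarrow>
           has_bochner_integral (interval_measure H) f b \<Longrightarrow>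
           has_bochner_integral (interval_measure (\<lambda>x. G x + H x)) f (a + b)"
      (is "?p1 \<Longrightarrow> ?p2 \<Longrightarrow> ?th2")
proof -
  note add = nn_integral_interval_measure_add[OF assms]
  show th1: ?th1
    by (auto simp: integrable_iff_bounded add cong: measurable_cong_sets)
  assume ?p1 ?p2
  then have int: "integrable (interval_measure G) f" "integrable (interval_measure H) f"
    and a: "a = integral\<^sup>L (interval_measure G) f" and b: "b = integral\<^sup>L (interval_measure H) f"
    by (auto simp: has_bochner_integral_iff)
  have f [measurable]: "f \<in> borel_measurable borel"
    using borel_measurable_integrable[OF int(1)] by simp
  have fin: "(\<integral>\<^sup>+x. ennreal (f x) \<partial>interval_measure K) < \<infinity>"
      "(\<integral>\<^sup>+x. ennreal (- f x) \<partial>interval_measure K) < \<infinity>"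
    if "integrable (interval_measure K) f" for K
    using that by (auto simp: real_integrable_def less_top)
  have "integral\<^sup>L (interval_measure (\<lambda>x. G x + H x)) f = a + b"
    using int th1 fin[OF int(1)] fin[OF int(2)] unfolding a b
    by (simp add: real_lebesgue_integral_def add enn2real_plus)
  with int th1 show ?th2 by (simp add: has_bochner_integral_iff)
qed

lemma has_stieltjes_integral_unique:
  assumes "has_stieltjes_integral f F I" "has_stieltjes_integral f F J"
  shows "I = J"
proof -
  obtain G H a b where 1: "mono G" "mono H"
      "\<And>x. continuous (at_right x) G" "\<And>x. continuous (at_right x) H"
      "\<And>x. F x = G x - H x" "has_bochner_integral (interval_measure G) f a"
      "has_bochner_integral (interval_measure H) f b" "I = a - b"
    using assms(1) unfolding has_stieltjes_integral_def by blast
  obtain G' H' a' b' where 2: "mono G'" "mono H'"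
      "\<And>x. continuous (at_right x) G'" "\<And>x. continuous (at_right x) H'"
      "\<And>x. F x = G' x - H' x" "has_bochner_integral (interval_measure G') f a'"
      "has_bochner_integral (interval_measure H') f b'" "J = a' - b'"
    using assms(2) unfolding has_stieltjes_integral_def by blast
  have "(\<lambda>x. G x + H' x) = (\<lambda>x. G' x + H x)"
  proof
    show "G x + H' x = G' x + H x" for x
      using 1(5)[of x] 2(5)[of x] by linarith
  qed
  moreover have "has_bochner_integral (interval_measure (\<lambda>x. G x + H' x)) f (a + b')"
    by (rule has_bochner_integral_interval_measure_add(2)) fact+
  moreover have "has_bochner_integral (interval_measure (\<lambda>x. G' x + H x)) f (a' + b)"
    by (rule has_bochner_integral_interval_measure_add(2)) fact+
  ultimately have "a + b' = a' + b"
    by (metis has_bochner_integral_eq)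
  then show ?thesis using 1(8) 2(8) by simp
qed

lemma has_stieltjes_integral_mono_iff:
  assumes F: "mono F" "\<And>x. continuous (at_right x) F"
  shows "has_stieltjes_integral f F I \<longleftrightarrow> has_bochner_integral (interval_measure F) f I"
proof
  assume *: "has_bochner_integral (interval_measure F) f I"
  have [measurable]: "f \<in> borel_measurable borel"
    using borel_measurable_has_bochner_integral[OF *] by simp
  have "emeasure (interval_measure (\<lambda>_. 0 :: real)) {- real i<..real i} = 0" for i :: nat
    by (simp add: emeasure_interval_measure_Ioc)
  then have "emeasure (interval_measure (\<lambda>_. 0 :: real)) (\<Union>i::nat. {- real i<..real i}) = 0"
    by (intro emeasure_UN_eq_0) auto
  then have "AE x in interval_measure (\<lambda>_. 0 :: real). f x = 0"
    by (intro AE_I[of _ _ UNIV]) (auto simp: UN_symmetric_Ioc)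
  then have "has_bochner_integral (interval_measure (\<lambda>_. 0 :: real)) f 0"
    using has_bochner_integral_zero[of "interval_measure (\<lambda>_. 0 :: real)"]
    by (subst has_bochner_integral_cong_AE[where g = "\<lambda>_. 0"]) auto
  then show "has_stieltjes_integral f F I"
    unfolding has_stieltjes_integral_def using F *
    by (intro exI[of _ F] exI[of _ "\<lambda>_. 0"] exI[of _ I] exI[of _ 0]) (auto intro: monoI)
next
  assume *: "has_stieltjes_integral f F I"
  then obtain G H a b where 1: "mono G" "mono H"
      "\<And>x. continuous (at_right x) G" "\<And>x. continuous (at_right x) H"
      "\<And>x. F x = G x - H x" "has_bochner_integral (interval_measure G) f a"
      "has_bochner_integral (interval_measure H) f b" "I = a - b"
    unfolding has_stieltjes_integral_def by blast
  have G: "G = (\<lambda>x. F x + H x)"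
  proof
    show "G x = F x + H x" for x using 1(5)[of x] by linarith
  qed
  have int: "integrable (interval_measure F) f"
    using has_bochner_integral_interval_measure_add(1)[OF F 1(2,4), of f] 1(6)
    by (simp add: G has_bochner_integral_iff)
  have "has_bochner_integral (interval_measure G) f (integral\<^sup>L (interval_measure F) f + b)"
    unfolding G
    by (rule has_bochner_integral_interval_measure_add(2)[OF F 1(2,4)])
      (use int 1(7) in \<open>auto simp: has_bochner_integral_iff\<close>)
  then have "a = integral\<^sup>L (interval_measure F) f + b"
    using 1(6) has_bochner_integral_eq by blast
  with int 1(8) show "has_bochner_integral (interval_measure F) f I"
    by (simp add: has_bochner_integral_iff)
qed


section \<open>The Airy function and the distribution function $F_0$\<close>

text \<open>The integral is only conditionally convergent, hence the explicit limit.\<close>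

definition Airy_Ai :: "real \<Rightarrow> real" where
  "Airy_Ai x = (1 / pi) * Lim at_top (\<lambda>R. integral {0..R} (\<lambda>t. cos (t ^ 3 / 3 + x * t)))"

definition painleve_II :: "(real \<Rightarrow> real) \<Rightarrow> bool" where
  "painleve_II u \<longleftrightarrow>
     (\<forall>x. u differentiable (at x)) \<and>
     (\<forall>x. (deriv u has_real_derivative 2 * u x ^ 3 + x * u x) (at x))"

definition v_of :: "(real \<Rightarrow> real) \<Rightarrow> real \<Rightarrow> real" where
  "v_of u x = - (LBINT s:{x..}. u s ^ 2)"

definition E_of :: "(real \<Rightarrow> real) \<Rightarrow> real \<Rightarrow> real" where
  "E_of u x = exp (1 / 2 * (LBINT s:{x..}. u s))"

definition F_GUE_of :: "(real \<Rightarrow> real) \<Rightarrow> real \<Rightarrow> real" where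
  "F_GUE_of u x = exp (LBINT s:{x..}. v_of u s)"

definition F0_of :: "(real \<Rightarrow> real) \<Rightarrow> real \<Rightarrow> real" where
  "F0_of u x =
     (1 - (x + 2 * deriv u x + 2 * u x ^ 2) * v_of u x) * E_of u x ^ 4 * F_GUE_of u x"

end

theory Submission
  imports Defs "HOL-Real_Asymp.Real_Asymp" "HOL-Probability.Sinc_Integral"
begin

text \<open>
  Put \<open>A = x + 2 u' + 2 u\<^sup>2\<close> and \<open>M = E\<^sup>4 F_GUE\<close>. Painleve II gives \<open>A' = 1 + 2 u A\<close>,
  and \<open>M' = - (2 u + v) M\<close>, so \<open>(A M)' = F0\<close>. Hence \<open>x F0 - A M\<close> is a primitive of
  \<open>x F0'\<close>, and the mean vanishes as soon as this primitive tends to \<open>0\<close> at both ends.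

  Neither the connection formula at \<open>-\<infinity>\<close> nor the precise behaviour of the Airy function is
  needed. Integration by parts shows that \<open>Ai\<close>, hence \<open>u\<close>, tends to \<open>0\<close> at \<open>+\<infinity>\<close>, and the
  maximum principle for \<open>u\<^sup>2\<close> upgrades this to exponential decay. At \<open>-\<infinity>\<close>, a global solution
  satisfies \<open>u\<^sup>2 \<le> - 4 x\<close> (otherwise it blows up to the left), so \<open>u\<close>, \<open>u'\<close>, \<open>v\<close> grow at most
  polynomially. With \<open>h = - v \<ge> 0\<close>, which is nonincreasing with \<open>h' = - u\<^sup>2\<close>, one has
  \<open>(ln (M / h\<^sup>2))' = h - 2 u + 2 u\<^sup>2 / h \<ge> h / 2\<close> by completing the square, so \<open>M\<close> decays
  exponentially unless \<open>u = 0\<close>.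
\<close>

section \<open>Integration on the real line\<close>

lemma continuous_antiderivative_exists:
  fixes g :: "real \<Rightarrow> real"
  assumes "\<And>x. isCont g x"
  obtains G where "\<And>x. (G has_real_derivative g x) (at x)"
  using einterval_antiderivative[of "-\<infinity>" "\<infinity>" g] assms
  by (auto simp: has_real_derivative_iff_has_vector_derivative)

text \<open>Both measures assign \<open>G b - G a\<close> to \<open>{a<..b}\<close>; these intervals
  form an intersection-stable generator of the Borel sets, and the symmetric ones exhaust the line
  with finite mass.\<close>

lemma interval_measure_eq_density:
  fixes G g :: "real \<Rightarrow> real"
  assumes deriv: "\<And>x. (G has_real_derivative g x) (at x)"
    and nonneg: "\<And>x. 0 \<le> g x" and cont: "\<And>x. isCont g x"
  shows "interval_measure G = density lborel g"
proof -
  have [measurable]: "g \<in> borel_measurable borel"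
    using cont by (auto intro!: borel_measurable_continuous_onI continuous_at_imp_continuous_on)
  have mono: "G x \<le> G y" if "x \<le> y" for x y
    using deriv nonneg that by (intro DERIV_nonneg_imp_nondecreasing[of x y G]) auto
  have contG: "continuous (at_right x) G" for x
    by (rule continuous_at_imp_continuous_at_within[OF DERIV_isCont[OF deriv]])
  have Ioc: "emeasure (density lborel g) {a<..b} = ennreal (G b - G a)" if "a \<le> b" for a b
  proof -
    have "emeasure (density lborel g) {a<..b} = (\<integral>\<^sup>+x. ennreal (g x) * indicator {a<..b} x \<partial>lborel)"
      by (simp add: emeasure_density)
    also have "\<dots> = (\<integral>\<^sup>+x. ennreal (g x) * indicator {a..b} x \<partial>lborel)"
    proof (rule nn_integral_cong_AE)
      show "AE x in lborel. ennreal (g x) * indicator {a<..b} x = ennreal (g x) * indicator {a..b} x"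
        using AE_lborel_singleton[of a] by eventually_elim (auto split: split_indicator)
    qed
    also have "\<dots> = ennreal (G b - G a)"
      by (rule nn_integral_FTC_Icc) (use nonneg deriv that in auto)
    finally show ?thesis .
  qed
  have Ioc': "emeasure (interval_measure G) {a<..b} = ennreal (G b - G a)" if "a \<le> b" for a b
    using that by (simp add: emeasure_interval_measure_Ioc mono contG)
  show ?thesis
  proof (rule measure_eqI_generator_eq[where \<Omega>=UNIV])
    show "(\<Union>i. {- real (i::nat)<..real i}) = UNIV"
      by (rule UN_symmetric_Ioc)
    fix X assume "X \<in> range (\<lambda>(a, b). {a<..b::real})"
    then obtain a b where "X = {a<..b}" by auto
    then show "emeasure (interval_measure G) X = emeasure (density lborel g) X"
      by (cases "a \<le> b") (auto simp: Ioc Ioc')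
  next
    show "emeasure (interval_measure G) {- real i<..real i} \<noteq> \<infinity>" for i :: nat
      by (simp add: Ioc')
  qed (auto simp: borel_sigma_sets_Ioc Int_stable_def)
qed

text \<open>The density \<open>f\<close> may change sign: its positive and negative parts
  \<open>p\<close> and \<open>n\<close> have nondecreasing primitives \<open>F + H\<close> and
  \<open>H\<close>, and these form the decomposition that the definition asks for.\<close>

lemma has_stieltjes_integral_C1:
  fixes F f \<phi> :: "real \<Rightarrow> real"
  assumes deriv: "\<And>x. (F has_real_derivative f x) (at x)" and cont: "\<And>x. isCont f x"
    and \<phi>: "\<phi> \<in> borel_measurable borel"
    and int: "has_bochner_integral lborel (\<lambda>x. f x * \<phi> x) I"
  shows "has_stieltjes_integral \<phi> F I"
proof -
  define p n where "p = (\<lambda>x. max 0 (f x))" and "n = (\<lambda>x. max 0 (- f x))"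
  have f_eq: "f = (\<lambda>x. p x - n x)" by (auto simp: p_def n_def max_def fun_eq_iff)
  have contn: "isCont n x" and contp: "isCont p x" for x
    unfolding p_def n_def by (intro continuous_intros cont)+
  have [measurable]: "p \<in> borel_measurable borel" "n \<in> borel_measurable borel"
    using contp contn
    by (auto intro!: borel_measurable_continuous_onI continuous_at_imp_continuous_on)
  note [measurable] = \<phi>
  obtain H where H: "\<And>x. (H has_real_derivative n x) (at x)"
    using continuous_antiderivative_exists contn by blast
  have G: "((\<lambda>x. F x + H x) has_real_derivative p x) (at x)" for x
    by (rule DERIV_cong[OF DERIV_add[OF deriv H]]) (simp add: f_eq)
  have intpn: "integrable lborel (\<lambda>x. p x * \<phi> x)" "integrable lborel (\<lambda>x. n x * \<phi> x)"
  proof -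
    have "integrable lborel (\<lambda>x. f x * \<phi> x)"
      using int by (simp add: has_bochner_integral_iff)
    moreover have "\<bar>p x\<bar> \<le> \<bar>f x\<bar>" "\<bar>n x\<bar> \<le> \<bar>f x\<bar>" for x
      by (auto simp: p_def n_def)
    ultimately show "integrable lborel (\<lambda>x. p x * \<phi> x)" "integrable lborel (\<lambda>x. n x * \<phi> x)"
      by (auto intro!: Bochner_Integration.integrable_bound[of _ "\<lambda>x. f x * \<phi> x"] mult_right_mono
          AE_I2 simp: abs_mult)
  qed
  have nonneg: "0 \<le> p x" "0 \<le> n x" for x by (auto simp: p_def n_def)
  have bp: "has_bochner_integral (interval_measure (\<lambda>x. F x + H x)) \<phi> (\<integral>x. p x * \<phi> x \<partial>lborel)"
    unfolding interval_measure_eq_density[OF G nonneg(1) contp]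
    using intpn nonneg by (intro has_bochner_integral_density) (auto simp: has_bochner_integral_iff)
  have bn: "has_bochner_integral (interval_measure H) \<phi> (\<integral>x. n x * \<phi> x \<partial>lborel)"
    unfolding interval_measure_eq_density[OF H nonneg(2) contn]
    using intpn nonneg by (intro has_bochner_integral_density) (auto simp: has_bochner_integral_iff)
  have "I = (\<integral>x. p x * \<phi> x \<partial>lborel) - (\<integral>x. n x * \<phi> x \<partial>lborel)"
    using int intpn by (simp add: has_bochner_integral_iff f_eq left_diff_distrib)
  moreover have "mono H" "mono (\<lambda>x. F x + H x)"
  proof -
    have "mono K" if "\<And>x. (K has_real_derivative k x) (at x)" "\<And>x. 0 \<le> k x" for K k :: "real \<Rightarrow> real"
    proof (rule monoI)
      show "K x \<le> K y" if "x \<le> y" for x y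
        using \<open>x \<le> y\<close> by (rule DERIV_nonneg_imp_nondecreasing)
          (use \<open>\<And>x. 0 \<le> k x\<close> \<open>\<And>x. (K has_real_derivative k x) (at x)\<close> in blast)
    qed
    from this[OF H nonneg(2)] this[OF G nonneg(1)] show "mono H" "mono (\<lambda>x. F x + H x)" .
  qed
  moreover have "continuous (at_right x) H" "continuous (at_right x) (\<lambda>x. F x + H x)" for x
    by (rule continuous_at_imp_continuous_at_within[OF DERIV_isCont], rule H)
       (rule continuous_at_imp_continuous_at_within[OF DERIV_isCont], rule G)
  ultimately show ?thesis
    unfolding has_stieltjes_integral_def using bp bn
    by (intro exI[of _ "\<lambda>x. F x + H x"] exI[of _ H] exI conjI) auto
qed

text \<open>The comparison function is \<open>1 / (1 + x^2)\<close>, which has the order of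
  \<open>1 / x^2\<close> at both ends but no singularity at 0. Between the tails, continuity on a
  compact interval supplies the constant.\<close>

lemma integrable_lborel_bigo:
  fixes h :: "real \<Rightarrow> real"
  assumes cont: "\<And>x. isCont h x"
    and top: "h \<in> O[at_top](\<lambda>x. 1 / x\<^sup>2)" and bot: "h \<in> O[at_bot](\<lambda>x. 1 / x\<^sup>2)"
  shows "integrable lborel h"
proof -
  have [measurable]: "h \<in> borel_measurable borel"
    using cont by (auto intro!: borel_measurable_continuous_onI continuous_at_imp_continuous_on)
  have "h \<in> O[at_top](\<lambda>x. inverse (1 + x\<^sup>2))"
    by (rule landau_o.big_trans[OF top]) real_asymp
  moreover have "h \<in> O[at_bot](\<lambda>x. inverse (1 + x\<^sup>2))"
    by (rule landau_o.big_trans[OF bot]) real_asymp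
  ultimately obtain c d where "eventually (\<lambda>x. \<bar>h x\<bar> \<le> c * inverse (1 + x\<^sup>2)) at_top"
    and "eventually (\<lambda>x. \<bar>h x\<bar> \<le> d * inverse (1 + x\<^sup>2)) at_bot"
    by (auto elim!: landau_o.bigE simp: abs_mult)
  then obtain a b where a: "\<And>x. x \<ge> a \<Longrightarrow> \<bar>h x\<bar> \<le> c * inverse (1 + x\<^sup>2)"
    and b: "\<And>x. x \<le> b \<Longrightarrow> \<bar>h x\<bar> \<le> d * inverse (1 + x\<^sup>2)"
    by (auto simp: eventually_at_top_linorder eventually_at_bot_linorder)
  have "continuous_on {b..a} (\<lambda>x. h x * (1 + x\<^sup>2))"
    by (intro continuous_at_imp_continuous_on ballI continuous_intros cont)
  then have "bounded ((\<lambda>x. h x * (1 + x\<^sup>2)) ` {b..a})"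
    by (intro compact_imp_bounded compact_continuous_image) auto
  then obtain e where e: "\<And>x. b \<le> x \<Longrightarrow> x \<le> a \<Longrightarrow> \<bar>h x * (1 + x\<^sup>2)\<bar> \<le> e"
    unfolding bounded_iff by (metis (no_types, lifting) atLeastAtMost_iff imageI real_norm_def)
  have bound: "norm (h x) \<le> norm (max c (max d e) * inverse (1 + x\<^sup>2))" for x
  proof -
    have pos: "0 < 1 + x\<^sup>2" by (simp add: add_pos_nonneg)
    obtain k where "\<bar>h x\<bar> \<le> k * inverse (1 + x\<^sup>2)" "k \<le> max c (max d e)"
    proof (cases "a \<le> x \<or> x \<le> b")
      case False
      then have "\<bar>h x\<bar> * (1 + x\<^sup>2) \<le> e"
        using e[of x] pos by (simp add: abs_mult)
      then show ?thesis using pos by (intro that[of e]) (simp_all add: field_simps)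
    next
      case True
      then show ?thesis using that a b by fastforce
    qed
    moreover have "k * inverse (1 + x\<^sup>2) \<le> max c (max d e) * inverse (1 + x\<^sup>2)"
      using \<open>k \<le> max c (max d e)\<close> pos by (intro mult_right_mono) auto
    ultimately show ?thesis by simp
  qed
  have "integrable lborel (\<lambda>x::real. max c (max d e) * inverse (1 + x\<^sup>2))"
    by (rule integrable_mult_right) (use integrable_inverse_1_plus_square in \<open>simp add: set_integrable_def\<close>)
  then show ?thesis
  proof (rule Bochner_Integration.integrable_bound)
    show "AE x in lborel. norm (h x) \<le> norm (max c (max d e) * inverse (1 + x\<^sup>2))"
      by (rule AE_I2, rule bound)
  qed simp
qed

lemma has_bochner_integral_FTC_real_line:
  fixes f F :: "real \<Rightarrow> real"
  assumes "\<And>x. (F has_real_derivative f x) (at x)" "\<And>x. isCont f x" "integrable lborel f"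
    and "(F \<longlongrightarrow> A) at_bot" "(F \<longlongrightarrow> B) at_top"
  shows "has_bochner_integral lborel f (B - A)"
proof -
  have "(LBINT x=-\<infinity>..\<infinity>. f x) = B - A"
    using assms
    by (intro interval_integral_FTC_integrable[where F=F])
       (auto simp: ereal_tendsto_simps has_real_derivative_iff_has_vector_derivative set_integrable_def)
  then show ?thesis
    using assms(3) by (simp add: has_bochner_integral_iff interval_lebesgue_integral_def set_lebesgue_integral_def)
qed

text \<open>Beyond \<open>b\<close> the exponential dominates, and the compact piece up to
  \<open>b\<close> is harmless by continuity. For the derivative, the tail is, up to a constant,
  minus a primitive \<open>G\<close> of \<open>g\<close>.\<close>

lemma exp_tail:
  fixes g :: "real \<Rightarrow> real"
  assumes cont: "\<And>x. isCont g x" and bound: "\<And>x. b \<le> x \<Longrightarrow> \<bar>g x\<bar> \<le> C * exp (- x)"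
  shows set_integrable_exp_tail: "set_integrable lborel {a..} g"
    and exp_tail_bound: "b \<le> a \<Longrightarrow> \<bar>LBINT s:{a..}. g s\<bar> \<le> C * exp (- a)"
    and DERIV_exp_tail: "((\<lambda>x. LBINT s:{x..}. g s) has_real_derivative - g x) (at x)"
proof -
  have [measurable]: "g \<in> borel_measurable borel"
    using cont by (auto intro!: borel_measurable_continuous_onI continuous_at_imp_continuous_on)
  \<comment> \<open>The bound at \<open>b\<close> itself forces the constant to be
    nonnegative.\<close>
  have "0 \<le> C * exp (- b)" using bound[of b] by linarith
  then have C: "0 \<le> C" by (simp add: zero_le_mult_iff)
  have bexp: "has_bochner_integral lborel (\<lambda>x. C * exp (- x) * indicator {a..} x) (C * exp (- a))" for a
  proof (rule has_bochner_integral_nn_integral)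
    have "(\<integral>\<^sup>+x. ennreal (C * exp (- x)) * indicator {a..} x \<partial>lborel) = 0 - (- C * exp (- a))"
    proof (rule nn_integral_FTC_atLeast)
      show "((\<lambda>x. - C * exp (- x)) \<longlongrightarrow> 0) at_top" by real_asymp
    qed (use C in \<open>auto intro!: derivative_eq_intros\<close>)
    then show "(\<integral>\<^sup>+x. ennreal (C * exp (- x) * indicator {a..} x) \<partial>lborel) = ennreal (C * exp (- a))"
      using C by (simp add: ennreal_mult ennreal_indicator)
  qed (use C in auto)
  have int1: "set_integrable lborel {a..} g" if "b \<le> a" for a
    unfolding set_integrable_def
    by (rule Bochner_Integration.integrable_bound[OF integrable.intros[OF bexp[of a]]])
       (use bound that C in \<open>auto split: split_indicator simp: abs_mult\<close>)
  have int: "set_integrable lborel {a..} g" for a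
  proof (cases "b \<le> a")
    case False
    have "set_integrable lborel {a..b} g"
      by (intro borel_integrable_atLeastAtMost' continuous_at_imp_continuous_on ballI cont)
    then have "set_integrable lborel ({a..b} \<union> {b..}) g"
      by (intro set_integrable_Un int1) auto
    moreover have "{a..b} \<union> {b..} = {a..}" using False by auto
    ultimately show ?thesis by simp
  qed (rule int1)
  show "set_integrable lborel {a..} g" by (rule int)
  show "\<bar>LBINT s:{a..}. g s\<bar> \<le> C * exp (- a)" if "b \<le> a"
  proof -
    have "integrable lborel (\<lambda>x. \<bar>indicator {a..} x * g x\<bar>)"
      using int[of a] by (intro integrable_abs) (simp add: set_integrable_def)
    then have "\<bar>LBINT s:{a..}. g s\<bar> \<le> (\<integral>x. C * exp (- x) * indicator {a..} x \<partial>lborel)"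
      unfolding set_lebesgue_integral_def using bexp[of a] bound that C
      by (intro integral_abs_bound[THEN order_trans] integral_mono)
         (auto simp: has_bochner_integral_iff split: split_indicator)
    then show ?thesis using bexp[of a] by (simp add: has_bochner_integral_iff)
  qed
  obtain G where G: "\<And>x. (G has_real_derivative g x) (at x)"
    using continuous_antiderivative_exists cont by blast
  have diff: "(LBINT s:{x..}. g s) = G y - G x + (LBINT s:{y..}. g s)" if "x \<le> y" for x y
  proof -
    have "(LBINT s:{x..<y}. g s) = (LBINT s=x..y. g s)"
      using that by (simp add: interval_integral_Ico)
    also have "\<dots> = G y - G x"
    proof (rule interval_integral_FTC_finite)
      show "continuous_on {min x y..max x y} g"
        by (intro continuous_at_imp_continuous_on ballI cont)
      show "(G has_vector_derivative g z) (at z within {min x y..max x y})" for z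
        using has_field_derivative_at_within[OF G]
        by (simp add: has_real_derivative_iff_has_vector_derivative)
    qed
    finally have "(LBINT s:{x..<y}. g s) = G y - G x" .
    moreover have "(LBINT s:{x..<y} \<union> {y..}. g s) = (LBINT s:{x..<y}. g s) + (LBINT s:{y..}. g s)"
      by (intro set_integral_Un int set_integrable_subset[OF int[of x]]) auto
    moreover have "{x..<y} \<union> {y..} = {x..}" using that by auto
    ultimately show ?thesis by simp
  qed
  have "(\<lambda>x. LBINT s:{x..}. g s) = (\<lambda>x. (LBINT s:{0..}. g s) + G 0 - G x)"
  proof
    show "(LBINT s:{x..}. g s) = (LBINT s:{0..}. g s) + G 0 - G x" for x
      using diff[of x 0] diff[of 0 x] by linarith
  qed
  then show "((\<lambda>x. LBINT s:{x..}. g s) has_real_derivative - g x) (at x)"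
    by (auto intro!: derivative_eq_intros G)
qed

section \<open>The Airy function at infinity\<close>

text \<open>Integration by parts with \<open>cos \<phi> = (sin \<phi>)' / \<phi>'\<close> and
  \<open>\<phi>' = t^2 + x\<close>. The remaining integrand is dominated by
  \<open>2 t / (t^2 + x)^2\<close>, the derivative of \<open>- 1 / (t^2 + x)\<close>.\<close>

lemma Airy_oscillatory_integral_bound:
  fixes x R S :: real
  assumes x: "0 < x" and R: "0 \<le> R" "R \<le> S"
  shows "\<bar>integral {R..S} (\<lambda>t. cos (t ^ 3 / 3 + x * t))\<bar> \<le> 2 / (R\<^sup>2 + x)"
proof -
  define \<phi> where "\<phi> = (\<lambda>t. t ^ 3 / 3 + x * t)"
  have pos: "0 < t\<^sup>2 + x" for t using x by (simp add: add_nonneg_pos)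
  have "((\<lambda>t. sin (\<phi> t) / (t\<^sup>2 + x)) has_real_derivative
      cos (\<phi> t) - sin (\<phi> t) * (2 * t / (t\<^sup>2 + x)\<^sup>2)) (at t within {R..S})" for t
  proof -
    have [derivative_intros]: "(\<phi> has_real_derivative t\<^sup>2 + x) (at t within {R..S})"
      unfolding \<phi>_def by (auto intro!: derivative_eq_intros)
    have "((\<lambda>t. sin (\<phi> t) / (t\<^sup>2 + x)) has_real_derivative
        (cos (\<phi> t) * (t\<^sup>2 + x) * (t\<^sup>2 + x) - sin (\<phi> t) * (2 * t)) / ((t\<^sup>2 + x) * (t\<^sup>2 + x)))
        (at t within {R..S})"
      using pos[of t] by (auto intro!: derivative_eq_intros)
    then show ?thesis
      by (rule DERIV_cong) (use pos[of t] in \<open>simp add: diff_divide_distrib power2_eq_square[of "t\<^sup>2 + x"]\<close>)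
  qed
  then have 1: "((\<lambda>t. cos (\<phi> t) - sin (\<phi> t) * (2 * t / (t\<^sup>2 + x)\<^sup>2)) has_integral
      sin (\<phi> S) / (S\<^sup>2 + x) - sin (\<phi> R) / (R\<^sup>2 + x)) {R..S}"
    using R by (intro fundamental_theorem_of_calculus)
      (auto simp: has_real_derivative_iff_has_vector_derivative)
  have "((\<lambda>t. - 1 / (t\<^sup>2 + x)) has_real_derivative 2 * t / (t\<^sup>2 + x)\<^sup>2) (at t within {R..S})" for t
    using pos[of t] by (auto intro!: derivative_eq_intros simp: field_simps power2_eq_square)
  then have 2: "((\<lambda>t. 2 * t / (t\<^sup>2 + x)\<^sup>2) has_integral - 1 / (S\<^sup>2 + x) - - 1 / (R\<^sup>2 + x)) {R..S}"
    using R by (intro fundamental_theorem_of_calculus)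
      (auto simp: has_real_derivative_iff_has_vector_derivative)
  have "continuous_on {R..S} (\<lambda>t. sin (\<phi> t) * (2 * t / (t\<^sup>2 + x)\<^sup>2))"
    unfolding \<phi>_def using pos by (intro continuous_intros) (auto simp: less_imp_neq[symmetric])
  then have 3: "(\<lambda>t. sin (\<phi> t) * (2 * t / (t\<^sup>2 + x)\<^sup>2)) integrable_on {R..S}"
    by (rule integrable_continuous_real)
  have "norm (integral {R..S} (\<lambda>t. sin (\<phi> t) * (2 * t / (t\<^sup>2 + x)\<^sup>2)))
      \<le> integral {R..S} (\<lambda>t. 2 * t / (t\<^sup>2 + x)\<^sup>2)"
  proof (rule integral_norm_bound_integral[OF 3])
    show "(\<lambda>t. 2 * t / (t\<^sup>2 + x)\<^sup>2) integrable_on {R..S}" using 2 by blast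
    fix t assume "t \<in> {R..S}"
    then have "0 \<le> 2 * t / (t\<^sup>2 + x)\<^sup>2" using R by auto
    from mult_right_mono[OF abs_sin_le_one[of "\<phi> t"] this]
    show "norm (sin (\<phi> t) * (2 * t / (t\<^sup>2 + x)\<^sup>2)) \<le> 2 * t / (t\<^sup>2 + x)\<^sup>2"
      using R \<open>t \<in> {R..S}\<close> by (simp add: abs_mult)
  qed
  then have 4: "\<bar>integral {R..S} (\<lambda>t. sin (\<phi> t) * (2 * t / (t\<^sup>2 + x)\<^sup>2))\<bar> \<le> 1 / (R\<^sup>2 + x) - 1 / (S\<^sup>2 + x)"
    using integral_unique[OF 2] by simp
  have "integral {R..S} (\<lambda>t. cos (\<phi> t)) = (sin (\<phi> S) / (S\<^sup>2 + x) - sin (\<phi> R) / (R\<^sup>2 + x))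
      + integral {R..S} (\<lambda>t. sin (\<phi> t) * (2 * t / (t\<^sup>2 + x)\<^sup>2))"
    using has_integral_add[OF 1 integrable_integral[OF 3]] by (auto intro: integral_unique)
  moreover have "\<bar>sin (\<phi> t) / (t\<^sup>2 + x)\<bar> \<le> 1 / (t\<^sup>2 + x)" for t
    using pos[of t] abs_sin_le_one[of "\<phi> t"] by (simp add: divide_right_mono)
  from this[of S] this[of R] have "\<bar>sin (\<phi> S) / (S\<^sup>2 + x) - sin (\<phi> R) / (R\<^sup>2 + x)\<bar>
      \<le> 1 / (S\<^sup>2 + x) + 1 / (R\<^sup>2 + x)" by linarith
  \<comment> \<open>The boundary terms contribute a sum and the dominated integral a difference of
    the same two quantities, so the terms in \<open>S\<close> cancel.\<close>
  ultimately have "\<bar>integral {R..S} (\<lambda>t. cos (\<phi> t))\<bar> \<le> 2 * (1 / (R\<^sup>2 + x))"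
    using 4 by linarith
  then show ?thesis by (simp add: \<phi>_def)
qed

text \<open>Since \<open>Airy_Ai\<close> is defined by \<open>Lim\<close>, the limit must be shown
  to exist before it can be estimated. The tail bound makes the truncated integrals Cauchy.\<close>

lemma Airy_Ai_bound:
  assumes x: "0 < x"
  shows "\<bar>Airy_Ai x\<bar> \<le> 2 / (pi * x)"
proof -
  define J where "J = (\<lambda>R. integral {0..R} (\<lambda>t. cos (t ^ 3 / 3 + x * t)))"
  have diff: "\<bar>J S - J R\<bar> \<le> 2 / (R\<^sup>2 + x)" if "0 \<le> R" "R \<le> S" for R S
  proof -
    have "(\<lambda>t. cos (t ^ 3 / 3 + x * t)) integrable_on {0..S}"
      by (intro integrable_continuous_real continuous_intros) auto
    then have "J S = J R + integral {R..S} (\<lambda>t. cos (t ^ 3 / 3 + x * t))"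
      unfolding J_def using that by (intro Henstock_Kurzweil_Integration.integral_combine[symmetric]) auto
    then show ?thesis using Airy_oscillatory_integral_bound[OF x that] by simp
  qed
  have lim0: "((\<lambda>R. 2 / (R\<^sup>2 + x)) \<longlongrightarrow> 0) at_top" by real_asymp
  \<comment> \<open>Completeness is used along the integers; \<open>near\<close> then carries the
    limit over to real cut-offs.\<close>
  have "Cauchy (\<lambda>n. J (real n))"
  proof (rule metric_CauchyI)
    fix e :: real assume "0 < e"
    then have "eventually (\<lambda>R. 2 / (R\<^sup>2 + x) < e / 2) at_top"
      by (intro order_tendstoD(2)[OF lim0]) simp
    then obtain r where r: "\<And>R. R \<ge> r \<Longrightarrow> 2 / (R\<^sup>2 + x) < e / 2"
      by (auto simp: eventually_at_top_linorder)
    define N where "N = nat \<lceil>max 0 r\<rceil>"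
    have N: "r \<le> real N" unfolding N_def by linarith
    have "dist (J (real m)) (J (real n)) < e" if "N \<le> m" "N \<le> n" for m n
    proof -
      have "\<bar>J (real k) - J (real N)\<bar> < e / 2" if "N \<le> k" for k
        using diff[of "real N" "real k"] r[OF N] that by simp
      from this[OF that(1)] this[OF that(2)] show ?thesis unfolding dist_real_def by linarith
    qed
    then show "\<exists>N. \<forall>m\<ge>N. \<forall>n\<ge>N. dist (J (real m)) (J (real n)) < e" by blast
  qed
  then obtain L where L: "(\<lambda>n. J (real n)) \<longlonglongrightarrow> L"
    using Cauchy_convergent convergent_def by blast
  have near: "\<bar>L - J R\<bar> \<le> 2 / (R\<^sup>2 + x)" if "0 \<le> R" for R
  proof (rule tendsto_upperbound)
    show "(\<lambda>n. \<bar>J (real n) - J R\<bar>) \<longlonglongrightarrow> \<bar>L - J R\<bar>" by (intro tendsto_intros L)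
    have "eventually (\<lambda>n. R \<le> real n) sequentially"
      using filterlim_real_sequentially by (simp add: filterlim_at_top)
    then show "eventually (\<lambda>n. \<bar>J (real n) - J R\<bar> \<le> 2 / (R\<^sup>2 + x)) sequentially"
      by eventually_elim (use diff that in auto)
  qed simp
  have "((\<lambda>R. J R - L) \<longlongrightarrow> 0) at_top"
  proof (rule Lim_null_comparison[OF _ lim0])
    show "eventually (\<lambda>R. norm (J R - L) \<le> 2 / (R\<^sup>2 + x)) at_top"
      using eventually_ge_at_top[of 0]
      by eventually_elim (use near in \<open>auto simp: abs_minus_commute\<close>)
  qed
  then have "(J \<longlongrightarrow> L) at_top" by (simp add: LIM_zero_iff)
  then have "Lim at_top J = L" by (intro tendsto_Lim) auto
  then have "Airy_Ai x = L / pi" by (simp add: Airy_Ai_def J_def)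
  \<comment> \<open>At \<open>R = 0\<close> the truncated integral vanishes, so \<open>near\<close>
    bounds the limit itself.\<close>
  moreover have "\<bar>L\<bar> \<le> 2 / x" using near[of 0] by (simp add: J_def)
  ultimately show ?thesis
    using divide_right_mono[of "\<bar>L\<bar>" "2 / x" pi] by (simp add: mult.commute)
qed

lemma Airy_Ai_tendsto_0: "(Airy_Ai \<longlongrightarrow> 0) at_top"
proof (rule Lim_null_comparison)
  show "eventually (\<lambda>x. norm (Airy_Ai x) \<le> 2 / (pi * x)) at_top"
    using eventually_gt_at_top[of 0] by eventually_elim (simp add: Airy_Ai_bound)
  show "((\<lambda>x. 2 / (pi * x)) \<longlongrightarrow> 0) at_top" by real_asymp
qed

section \<open>Global solutions of Painleve II decaying at infinity\<close>

text \<open>A positive value would force a positive maximum inside \<open>{a..}\<close>, because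
  \<open>w\<close> is nonpositive at \<open>a\<close> and eventually falls below any positive level.
  Strict convexity there excludes a maximum.\<close>

lemma maximum_principle_at_top:
  fixes w w' w'' :: "real \<Rightarrow> real"
  assumes w: "\<And>x. (w has_real_derivative w' x) (at x)"
    and w': "\<And>x. (w' has_real_derivative w'' x) (at x)"
    and "w a \<le> 0" "(w \<longlongrightarrow> L) at_top" "L \<le> 0"
    and convex: "\<And>x. a < x \<Longrightarrow> 0 < w x \<Longrightarrow> 0 < w'' x"
    and "a \<le> x"
  shows "w x \<le> 0"
proof (rule ccontr)
  assume "\<not> w x \<le> 0"
  then have "eventually (\<lambda>y. w y < w x) at_top"
    using assms(4,5) by (intro order_tendstoD(2)) auto
  then obtain b0 where b0: "\<And>y. b0 \<le> y \<Longrightarrow> w y < w x"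
    by (auto simp: eventually_at_top_linorder)
  define b where "b = max b0 x"
  have cont: "continuous_on S w" for S
    by (intro continuous_at_imp_continuous_on ballI DERIV_isCont[OF w])
  obtain z where z: "z \<in> {a..b}" "\<And>y. y \<in> {a..b} \<Longrightarrow> w y \<le> w z"
    using continuous_attains_sup[OF _ _ cont, of "{a..b}"] \<open>a \<le> x\<close> unfolding b_def
    by (metis atLeastatMost_empty_iff compact_Icc max.coboundedI2 not_le)
  \<comment> \<open>Beyond \<open>b\<close> the function stays below \<open>w x\<close>, and
    \<open>x\<close> lies in \<open>{a..b}\<close>, so the maximum over the compact interval is
    global.\<close>
  have max: "w y \<le> w z" if "a \<le> y" for y
    using z(2)[of y] z(2)[of x] b0[of y] that \<open>a \<le> x\<close> by (cases "y \<le> b") (auto simp: b_def le_max_iff_disj)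
  from max[OF \<open>a \<le> x\<close>] \<open>\<not> w x \<le> 0\<close> have pos: "0 < w z" by linarith
  with \<open>w a \<le> 0\<close> z have az: "a < z" by (cases "z = a") auto
  have "w' z = 0"
  proof (rule DERIV_local_max[OF w])
    show "0 < z - a" using az by simp
    show "\<forall>y. \<bar>z - y\<bar> < z - a \<longrightarrow> w y \<le> w z" using max by auto
  qed
  \<comment> \<open>Second derivative test: \<open>w' z = 0\<close> and \<open>w'' z > 0\<close>
    make \<open>w'\<close> positive just to the right of \<open>z\<close>.\<close>
  obtain d where d: "0 < d" "\<And>h. 0 < h \<Longrightarrow> h < d \<Longrightarrow> w' z < w' (z + h)"
    using DERIV_pos_inc_right[OF w' convex[OF az pos]] by blast
  have "w z < w (z + d / 2)"
  proof (rule DERIV_pos_imp_increasing_open[where f = w])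
    show "z < z + d / 2" using d by simp
    show "continuous_on {z..z + d / 2} w" by (rule cont)
    fix y assume "z < y" "y < z + d / 2"
    then have "0 < w' y" using d(2)[of "y - z"] \<open>w' z = 0\<close> by simp
    then show "\<exists>l. (w has_real_derivative l) (at y) \<and> 0 < l" using w by blast
  qed
  with max[of "z + d / 2"] az d show False by simp
qed

locale decaying_painleve_II =
  fixes u u' :: "real \<Rightarrow> real"
  assumes deriv_u: "\<And>x. (u has_real_derivative u' x) (at x)"
    and deriv_u': "\<And>x. (u' has_real_derivative 2 * u x ^ 3 + x * u x) (at x)"
    and u_tendsto_0: "(u \<longlongrightarrow> 0) at_top"
begin

section \<open>Maximum principle for the squared solution and exponential decay\<close>

lemma isCont_u [continuous_intros]: "isCont u x"
  by (rule DERIV_isCont[OF deriv_u])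

lemma deriv_u_squared: "((\<lambda>x. (u x)\<^sup>2) has_real_derivative 2 * u x * u' x) (at x)"
  by (auto intro!: derivative_eq_intros deriv_u)

lemma deriv2_u_squared:
  "((\<lambda>x. 2 * u x * u' x) has_real_derivative 2 * (u' x)\<^sup>2 + 2 * (u x)\<^sup>2 * (2 * (u x)\<^sup>2 + x)) (at x)"
  by (auto intro!: derivative_eq_intros deriv_u deriv_u' simp: algebra_simps power2_eq_square power3_eq_cube)

text \<open>\<open>(u^2)'' = 2 u'^2 + 2 u^2 (2 u^2 + x)\<close> is positive where \<open>u\<close>
  is nonzero and \<open>2 u^2 + x > 0\<close>. To the right of \<open>a\<close>, a point where
  \<open>u^2\<close> exceeds its value at \<open>a\<close> inherits the latter inequality from
  \<open>a\<close>. The base point may be negative, which the estimates on the left exploit.\<close>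

lemma u_squared_le:
  assumes a: "0 < 2 * (u a)\<^sup>2 + a" and "a \<le> x"
  shows "(u x)\<^sup>2 \<le> (u a)\<^sup>2"
proof -
  have "(u x)\<^sup>2 - (u a)\<^sup>2 \<le> 0"
  proof (rule maximum_principle_at_top[where w = "\<lambda>x. (u x)\<^sup>2 - (u a)\<^sup>2"])
    show "((\<lambda>x. (u x)\<^sup>2 - (u a)\<^sup>2) has_real_derivative 2 * u x * u' x) (at x)" for x
      using DERIV_diff[OF deriv_u_squared DERIV_const[of "(u a)\<^sup>2"]] by simp
    show "((\<lambda>x. (u x)\<^sup>2 - (u a)\<^sup>2) \<longlongrightarrow> 0\<^sup>2 - (u a)\<^sup>2) at_top"
      by (intro tendsto_intros u_tendsto_0)
    fix y assume y: "a < y" "0 < (u y)\<^sup>2 - (u a)\<^sup>2"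
    have "0 < (u y)\<^sup>2" using y(2) zero_le_power2[of "u a"] by linarith
    moreover have "0 < 2 * (u y)\<^sup>2 + y" using a y by linarith
    ultimately have "0 < 2 * (u y)\<^sup>2 * (2 * (u y)\<^sup>2 + y)" by simp
    then show "0 < 2 * (u' y)\<^sup>2 + 2 * (u y)\<^sup>2 * (2 * (u y)\<^sup>2 + y)"
      by (intro add_nonneg_pos) auto
  qed (use \<open>a \<le> x\<close> deriv2_u_squared in auto)
  then show ?thesis by simp
qed

text \<open>Otherwise \<open>u^2\<close> would increase just to the right of \<open>a\<close>,
  against \<open>u_squared_le\<close>.\<close>

lemma u_mult_deriv_nonpos:
  assumes "0 < 2 * (u a)\<^sup>2 + a"
  shows "u a * u' a \<le> 0"
proof (rule ccontr)
  assume "\<not> u a * u' a \<le> 0"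
  then obtain d where "0 < d" "\<And>h. 0 < h \<Longrightarrow> h < d \<Longrightarrow> (u a)\<^sup>2 < (u (a + h))\<^sup>2"
    using DERIV_pos_inc_right[OF deriv_u_squared[of a]] by auto
  then have "(u a)\<^sup>2 < (u (a + d / 2))\<^sup>2" by simp
  with u_squared_le[OF assms, of "a + d / 2"] \<open>0 < d\<close> show False by simp
qed

text \<open>Normalised so that \<open>K * exp (- x)\<close> agrees with
  \<open>\<bar>u x\<bar>\<close> at \<open>x = 2\<close>, where the comparison starts.\<close>

definition K :: real where "K = \<bar>u 2\<bar> * exp 2"

text \<open>Maximum principle for \<open>u^2 - K^2 exp (- 2 x)\<close>. For \<open>x > 2\<close> the
  coefficient \<open>2 u^2 + x\<close> is at least 2, hence \<open>(u^2)'' \<ge> 4 u^2\<close>,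
  while the comparison function satisfies this with equality; the difference is therefore strictly
  convex where it is positive.\<close>

lemma u_exp_bound:
  assumes "2 \<le> x"
  shows "\<bar>u x\<bar> \<le> K * exp (- x)"
proof -
  have "(u x)\<^sup>2 - K\<^sup>2 * exp (- 2 * x) \<le> 0"
  proof (rule maximum_principle_at_top[where w = "\<lambda>x. (u x)\<^sup>2 - K\<^sup>2 * exp (- 2 * x)" and a = 2 and L = 0
        and w' = "\<lambda>x. 2 * u x * u' x + 2 * K\<^sup>2 * exp (- 2 * x)"
        and w'' = "\<lambda>x. 2 * (u' x)\<^sup>2 + 2 * (u x)\<^sup>2 * (2 * (u x)\<^sup>2 + x) - 4 * K\<^sup>2 * exp (- 2 * x)"])
    show "((\<lambda>x. (u x)\<^sup>2 - K\<^sup>2 * exp (- 2 * x)) has_real_derivative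
        2 * u x * u' x + 2 * K\<^sup>2 * exp (- 2 * x)) (at x)" for x
      by (rule derivative_eq_intros deriv_u_squared refl | simp)+
    show "((\<lambda>x. 2 * u x * u' x + 2 * K\<^sup>2 * exp (- 2 * x)) has_real_derivative
        2 * (u' x)\<^sup>2 + 2 * (u x)\<^sup>2 * (2 * (u x)\<^sup>2 + x) - 4 * K\<^sup>2 * exp (- 2 * x)) (at x)" for x
      by (rule derivative_eq_intros deriv2_u_squared refl | simp)+
    have "((\<lambda>x. (u x)\<^sup>2 - K\<^sup>2 * exp (- 2 * x)) \<longlongrightarrow> 0\<^sup>2 - K\<^sup>2 * 0) at_top"
      by (intro tendsto_intros u_tendsto_0) real_asymp
    then show "((\<lambda>x. (u x)\<^sup>2 - K\<^sup>2 * exp (- 2 * x)) \<longlongrightarrow> 0) at_top" by simp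
    show "(u 2)\<^sup>2 - K\<^sup>2 * exp (- 2 * 2) \<le> 0"
      by (simp add: K_def power_mult_distrib mult.assoc flip: exp_double exp_add)
    fix y :: real assume y: "2 < y" "0 < (u y)\<^sup>2 - K\<^sup>2 * exp (- 2 * y)"
    have "2 \<le> 2 * (u y)\<^sup>2 + y" using y(1) zero_le_power2[of "u y"] by linarith
    then have "(u y)\<^sup>2 * 2 \<le> (u y)\<^sup>2 * (2 * (u y)\<^sup>2 + y)"
      by (rule mult_left_mono) simp
    then show "0 < 2 * (u' y)\<^sup>2 + 2 * (u y)\<^sup>2 * (2 * (u y)\<^sup>2 + y) - 4 * K\<^sup>2 * exp (- 2 * y)"
      using y(2) zero_le_power2[of "u' y"] unfolding mult.assoc by linarith
  qed (use assms in auto)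
  then have "(u x)\<^sup>2 \<le> (K * exp (- x))\<^sup>2"
    by (simp add: power_mult_distrib flip: exp_double)
  moreover have "0 \<le> K * exp (- x)" by (simp add: K_def)
  ultimately show ?thesis by (simp add: abs_le_square_iff[symmetric])
qed

lemma u_squared_exp_bound:
  assumes "2 \<le> x"
  shows "\<bar>(u x)\<^sup>2\<bar> \<le> K\<^sup>2 * exp (- x)"
proof -
  have "\<bar>u x\<bar>\<^sup>2 \<le> (K * exp (- x))\<^sup>2"
    using u_exp_bound[OF assms] by (rule power_mono) simp
  also have "\<dots> = K\<^sup>2 * exp (- (2 * x))" by (simp add: power_mult_distrib flip: exp_double)
  also have "\<dots> \<le> K\<^sup>2 * exp (- x)" using assms by (intro mult_left_mono) auto
  finally show ?thesis by simp
qed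

lemma x_u_squared_tendsto_0: "((\<lambda>x. x * (u x)\<^sup>2) \<longlongrightarrow> 0) at_top"
proof (rule Lim_null_comparison)
  show "eventually (\<lambda>x. norm (x * (u x)\<^sup>2) \<le> K\<^sup>2 * (x * exp (- x))) at_top"
    using eventually_ge_at_top[of 2]
  proof eventually_elim
    case (elim x)
    then have "x * \<bar>(u x)\<^sup>2\<bar> \<le> x * (K\<^sup>2 * exp (- x))"
      by (intro mult_left_mono u_squared_exp_bound) auto
    with elim show ?case by (simp add: abs_mult mult_ac)
  qed
  have "((\<lambda>x::real. x * exp (- x)) \<longlongrightarrow> 0) at_top" by real_asymp
  then show "((\<lambda>x. K\<^sup>2 * (x * exp (- x))) \<longlongrightarrow> 0) at_top" by (rule tendsto_mult_right_zero)
qed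

section \<open>The Hamiltonian and the tail integral of the squared solution\<close>

text \<open>The Hamiltonian of the equation, which gives a closed form of \<open>- v_of u\<close>.\<close>

definition h :: "real \<Rightarrow> real" where "h x = (u' x)\<^sup>2 - u x ^ 4 - x * (u x)\<^sup>2"

lemma deriv_h: "(h has_real_derivative - (u x)\<^sup>2) (at x)"
  unfolding h_def
  by (rule derivative_eq_intros deriv_u deriv_u' refl)+ (simp add: power2_eq_square power3_eq_cube algebra_simps)

lemma h_antimono: "x \<le> y \<Longrightarrow> h y \<le> h x"
  by (rule DERIV_nonpos_imp_nonincreasing[where f = h], assumption) (intro exI conjI, rule deriv_h, simp)

text \<open>Decay of \<open>u'\<close> is only deduced from this. Dropping \<open>(u' x)^2\<close>
  gives the lower bound; above, monotonicity compares \<open>h x\<close> with \<open>h z\<close> at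
  a mean value point \<open>z\<close> between \<open>x - 1\<close> and \<open>x\<close>, where
  \<open>u' z\<close> is a difference of values of \<open>u\<close>.\<close>

lemma h_tendsto_0: "(h \<longlongrightarrow> 0) at_top"
proof (rule tendsto_sandwich)
  from x_u_squared_tendsto_0 have "((\<lambda>x. - (u x ^ 4) - x * (u x)\<^sup>2) \<longlongrightarrow> - (0 ^ 4) - 0) at_top"
    by (intro tendsto_intros u_tendsto_0)
  then show "((\<lambda>x. - (u x ^ 4) - x * (u x)\<^sup>2) \<longlongrightarrow> 0) at_top" by simp
  show "eventually (\<lambda>x. - (u x ^ 4) - x * (u x)\<^sup>2 \<le> h x) at_top"
    by (rule always_eventually) (simp add: h_def)
  have "((\<lambda>x. u (x - 1)) \<longlongrightarrow> 0) at_top"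
    by (rule filterlim_compose[OF u_tendsto_0]) real_asymp
  then have "((\<lambda>x. (u x - u (x - 1))\<^sup>2) \<longlongrightarrow> (0 - 0)\<^sup>2) at_top"
    by (intro tendsto_intros u_tendsto_0)
  then show "((\<lambda>x. (u x - u (x - 1))\<^sup>2) \<longlongrightarrow> 0) at_top" by simp
  show "eventually (\<lambda>x. h x \<le> (u x - u (x - 1))\<^sup>2) at_top"
    using eventually_ge_at_top[of 1]
  proof eventually_elim
    case (elim x)
    obtain z where z: "x - 1 < z" "z < x" "u x - u (x - 1) = (x - (x - 1)) * u' z"
      using MVT2[of "x - 1" x u u'] deriv_u by auto
    have "h x \<le> h z" using z by (intro h_antimono) auto
    also have "\<dots> \<le> (u' z)\<^sup>2"
    proof -
      have "0 \<le> u z ^ 4" "0 \<le> z * (u z)\<^sup>2" using z(1) elim by auto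
      then show ?thesis unfolding h_def by linarith
    qed
    finally show ?case using z by simp
  qed
qed

lemma h_nonneg: "0 \<le> h x"
proof (rule tendsto_upperbound[OF h_tendsto_0])
  show "eventually (\<lambda>y. h y \<le> h x) at_top"
    using eventually_ge_at_top[of x] by eventually_elim (rule h_antimono)
qed simp

lemma u'_squared: "(u' x)\<^sup>2 = u x ^ 4 + x * (u x)\<^sup>2 + h x"
  by (simp add: h_def)

lemma integral_u_squared: "(LBINT s:{x..}. (u s)\<^sup>2) = h x"
proof -
  have [measurable]: "u \<in> borel_measurable borel"
    by (auto intro!: borel_measurable_continuous_onI continuous_at_imp_continuous_on isCont_u)
  have "(\<integral>\<^sup>+s. ennreal ((u s)\<^sup>2) * indicator {x..} s \<partial>lborel) = 0 - (- h x)"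
  proof (rule nn_integral_FTC_atLeast)
    show "((\<lambda>x. - h x) has_real_derivative (u y)\<^sup>2) (at y)" for y
      using DERIV_minus[OF deriv_h] by simp
    show "((\<lambda>x. - h x) \<longlongrightarrow> 0) at_top" using tendsto_minus[OF h_tendsto_0] by simp
  qed auto
  then have "has_bochner_integral lborel (\<lambda>s. (u s)\<^sup>2 * indicator {x..} s) (h x)"
    by (intro has_bochner_integral_nn_integral)
       (auto simp: ennreal_mult ennreal_indicator h_nonneg)
  then show ?thesis
    by (simp add: set_lebesgue_integral_def has_bochner_integral_iff mult.commute)
qed

lemma v_of_eq: "v_of u = (\<lambda>x. - h x)"
  by (simp add: fun_eq_iff v_of_def integral_u_squared)

lemma h_exp_bound: "2 \<le> x \<Longrightarrow> \<bar>h x\<bar> \<le> K\<^sup>2 * exp (- x)"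
  unfolding integral_u_squared[symmetric]
  by (rule exp_tail_bound[OF _ u_squared_exp_bound]) (auto intro!: continuous_intros)

text \<open>The Hamiltonian is solved for \<open>u'^2\<close>, all other terms of which tend to
  0.\<close>

lemma u'_tendsto_0: "(u' \<longlongrightarrow> 0) at_top"
proof -
  from x_u_squared_tendsto_0 have "((\<lambda>x. sqrt (u x ^ 4 + x * (u x)\<^sup>2 + h x)) \<longlongrightarrow> sqrt (0 ^ 4 + 0 + 0)) at_top"
    by (intro tendsto_intros u_tendsto_0 h_tendsto_0)
  then have "((\<lambda>x. \<bar>u' x\<bar>) \<longlongrightarrow> 0) at_top" by (simp flip: u'_squared)
  then show ?thesis by (rule tendsto_rabs_zero_cancel)
qed

section \<open>Growth bounds to the left\<close>

lemma u_mult_deriv_le: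
  assumes z: "z \<le> - 1" "- 4 * z < (u z)\<^sup>2"
  shows "u z * u' z \<le> - ((u z)\<^sup>2 * \<bar>u z\<bar>) / 2"
proof -
  have "((u z)\<^sup>2 * \<bar>u z\<bar> / 2)\<^sup>2 = (u z)\<^sup>2 * ((u z)\<^sup>2 * ((u z)\<^sup>2 / 4))"
    by (simp add: power2_eq_square)
  \<comment> \<open>The assumption gives \<open>u^2 + z > 3/4 u^2\<close>, so the factor
    \<open>1/4\<close> leaves room to spare.\<close>
  also have "\<dots> \<le> (u z)\<^sup>2 * ((u z)\<^sup>2 * ((u z)\<^sup>2 + z))"
    using z by (intro mult_left_mono) auto
  also have "\<dots> \<le> (u z)\<^sup>2 * (u' z)\<^sup>2"
    unfolding u'_squared using h_nonneg[of z]
    by (intro mult_left_mono) (auto simp: power2_eq_square power4_eq_xxxx algebra_simps)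
  also have "\<dots> = (u z * u' z)\<^sup>2" by (simp add: power_mult_distrib)
  finally have "(u z)\<^sup>2 * \<bar>u z\<bar> / 2 \<le> \<bar>u z * u' z\<bar>"
    by (simp add: abs_le_square_iff[symmetric])
  \<comment> \<open>The sign turns the bound on the modulus into an upper bound.\<close>
  moreover have "u z * u' z \<le> 0" using z by (intro u_mult_deriv_nonpos) auto
  ultimately show ?thesis by linarith
qed

text \<open>A solution exceeding this bound would blow up in finite time to the left.\<close>

lemma u_squared_bound_left:
  assumes a: "a \<le> - 1"
  shows "(u a)\<^sup>2 \<le> - 4 * a"
proof (rule ccontr)
  assume "\<not> (u a)\<^sup>2 \<le> - 4 * a"
  then have pos: "0 < (u a)\<^sup>2 + 4 * a" by simp
  \<comment> \<open>The inequality propagates to the left: the maximum of \<open>p\<close> on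
    \<open>{x..a}\<close> is positive, \<open>p\<close> is strictly decreasing at such a point, so
    the maximum sits at the left end \<open>x\<close>.\<close>
  have large: "- 4 * x < (u x)\<^sup>2" if "x \<le> a" for x
  proof -
    define p where "p = (\<lambda>x. (u x)\<^sup>2 + 4 * x)"
    have p: "(p has_real_derivative 2 * (u z * u' z) + 4) (at z)" for z
      unfolding p_def by (auto intro!: derivative_eq_intros deriv_u)
    have cont: "continuous_on S p" for S
      by (intro continuous_at_imp_continuous_on ballI DERIV_isCont[OF p])
    obtain z where z: "x \<le> z" "z \<le> a" and max: "\<And>y. x \<le> y \<Longrightarrow> y \<le> a \<Longrightarrow> p y \<le> p z"
      using continuous_attains_sup[OF _ _ cont, of "{x..a}"] \<open>x \<le> a\<close>
      by (metis atLeastAtMost_iff atLeastatMost_empty_iff compact_Icc not_le)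
    have "0 < p z" using max[of a] pos \<open>x \<le> a\<close> by (simp add: p_def)
    then have lz: "- 4 * z < (u z)\<^sup>2" "z \<le> - 1" using z a by (auto simp: p_def)
    then have "2\<^sup>2 \<le> (u z)\<^sup>2" by simp
    then have "2 \<le> \<bar>u z\<bar>" using power2_le_imp_le[of 2 "\<bar>u z\<bar>"] by simp
    then have "2\<^sup>2 * 2 \<le> (u z)\<^sup>2 * \<bar>u z\<bar>"
      using \<open>2\<^sup>2 \<le> (u z)\<^sup>2\<close> by (intro mult_mono) auto
    \<comment> \<open>By \<open>u_mult_deriv_le\<close> and
      \<open>u^2 * \<bar>u\<bar> \<ge> 8\<close> the left side is at most
      \<open>- 8 + 4\<close>.\<close>
    then have "2 * (u z * u' z) + 4 < 0"
      using u_mult_deriv_le[OF lz(2,1)] by simp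
    from DERIV_neg_dec_left[OF p this] obtain d
      where d: "0 < d" "\<And>h. 0 < h \<Longrightarrow> h < d \<Longrightarrow> p z < p (z - h)" by blast
    have "z = x"
    proof (rule ccontr)
      assume "z \<noteq> x"
      then obtain e where "0 < e" "e < d" "e < z - x"
        using field_lbound_gt_zero[of d "z - x"] d(1) z by auto
      then show False using d(2)[of e] max[of "z - e"] z by auto
    qed
    with \<open>0 < p z\<close> show ?thesis by (simp add: p_def)
  qed
  \<comment> \<open>The reciprocal turns blow-up into a zero: its derivative is at least
    \<open>1 / 2\<close>, so \<open>r\<close> drops by at least half of the distance travelled to
    the left.\<close>
  define r where "r = (\<lambda>x. 1 / \<bar>u x\<bar>)"
  have nz: "u x \<noteq> 0" if "x \<le> a" for x using large[OF that] a that by auto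
  have r: "(r has_real_derivative - (u x * u' x) / ((u x)\<^sup>2 * \<bar>u x\<bar>)) (at x)" if "x \<le> a" for x
  proof -
    \<comment> \<open>Writing \<open>\<bar>u\<bar>\<close> as \<open>sqrt q\<close> avoids a case
      split on the sign of \<open>u\<close>.\<close>
    define q where "q = (\<lambda>x. (u x)\<^sup>2)"
    have q: "(q has_real_derivative 2 * (u x * u' x)) (at x)"
      using deriv_u_squared[of x] by (simp add: q_def mult.assoc)
    have "0 < q x" using nz[OF that] by (simp add: q_def)
    then have "((\<lambda>x. 1 / sqrt (q x)) has_real_derivative - (u x * u' x) / (q x * sqrt (q x))) (at x)"
      by (auto intro!: derivative_eq_intros q simp: field_simps)
    then show ?thesis by (simp add: r_def q_def)
  qed
  \<comment> \<open>Here a line of slope \<open>1 / 2\<close> through the value \<open>r a\<close>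
    at \<open>a\<close> reaches 0.\<close>
  define b where "b = a - 2 * r a"
  have "b \<le> a" by (simp add: b_def r_def)
  have "r b - b / 2 \<le> r a - a / 2"
  proof (rule DERIV_nonneg_imp_nondecreasing[OF \<open>b \<le> a\<close>], intro exI conjI)
    fix x assume "b \<le> x" "x \<le> a"
    show "((\<lambda>x. r x - x / 2) has_real_derivative - (u x * u' x) / ((u x)\<^sup>2 * \<bar>u x\<bar>) - 1 / 2) (at x)"
      by (auto intro!: derivative_eq_intros r \<open>x \<le> a\<close>)
    have "0 < (u x)\<^sup>2 * \<bar>u x\<bar>" using nz[OF \<open>x \<le> a\<close>] by simp
    then show "0 \<le> - (u x * u' x) / ((u x)\<^sup>2 * \<bar>u x\<bar>) - 1 / 2"
      using u_mult_deriv_le[OF _ large[OF \<open>x \<le> a\<close>]] a \<open>x \<le> a\<close>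
      by (simp add: field_simps)
  qed
  then have "r b \<le> 0" by (simp add: b_def diff_divide_distrib)
  with nz[OF \<open>b \<le> a\<close>] show False by (simp add: r_def)
qed

text \<open>This is \<open>u^2 \<le> - 4 x\<close> integrated: it makes \<open>h - 2 x^2\<close>
  nondecreasing up to \<open>- 1\<close>.\<close>

lemma h_bound_left:
  assumes "x \<le> - 1"
  shows "h x \<le> h (- 1) + 2 * x\<^sup>2"
proof -
  have "h x - 2 * x\<^sup>2 \<le> h (- 1) - 2 * (- 1)\<^sup>2"
  proof (rule DERIV_nonneg_imp_nondecreasing[OF assms], intro exI conjI)
    fix y :: real assume y: "y \<le> - 1"
    show "((\<lambda>x. h x - 2 * x\<^sup>2) has_real_derivative - (u y)\<^sup>2 - 4 * y) (at y)"
      by (auto intro!: derivative_eq_intros deriv_h)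
    show "0 \<le> - (u y)\<^sup>2 - 4 * y" using u_squared_bound_left[OF y] by simp
  qed
  then show ?thesis by simp
qed

section \<open>The distribution function, its derivative and a primitive for the mean\<close>

definition M :: "real \<Rightarrow> real" where
  "M x = exp (2 * (LBINT s:{x..}. u s) + (LBINT s:{x..}. - h s))"

definition A :: "real \<Rightarrow> real" where "A x = x + 2 * u' x + 2 * (u x)\<^sup>2"

lemma isCont_h [continuous_intros]: "isCont h x"
  by (rule DERIV_isCont[OF deriv_h])

lemma deriv_integral_u: "((\<lambda>x. LBINT s:{x..}. u s) has_real_derivative - u x) (at x)"
  by (rule DERIV_exp_tail[OF isCont_u u_exp_bound])

lemma integral_h_tail:
  shows deriv_integral_h: "((\<lambda>x. LBINT s:{x..}. - h s) has_real_derivative h x) (at x)"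
    and integral_h_bound: "2 \<le> x \<Longrightarrow> \<bar>LBINT s:{x..}. - h s\<bar> \<le> K\<^sup>2 * exp (- x)"
proof -
  have cont: "isCont (\<lambda>x. - h x) y" for y by (intro continuous_intros)
  have bound: "2 \<le> y \<Longrightarrow> \<bar>- h y\<bar> \<le> K\<^sup>2 * exp (- y)" for y using h_exp_bound by simp
  show "((\<lambda>x. LBINT s:{x..}. - h s) has_real_derivative h x) (at x)"
    using DERIV_exp_tail[OF cont bound] by simp
  show "2 \<le> x \<Longrightarrow> \<bar>LBINT s:{x..}. - h s\<bar> \<le> K\<^sup>2 * exp (- x)"
    by (rule exp_tail_bound[OF cont bound])
qed

lemma deriv_M: "(M has_real_derivative (h x - 2 * u x) * M x) (at x)"
  unfolding M_def
  by (rule derivative_eq_intros deriv_integral_u deriv_integral_h refl)+ (simp add: algebra_simps)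

lemma isCont_M [continuous_intros]: "isCont M x"
  by (rule DERIV_isCont[OF deriv_M])

lemma deriv_A: "(A has_real_derivative 1 + 2 * u x * A x) (at x)"
  unfolding A_def
  by (rule derivative_eq_intros deriv_u deriv_u' refl)+
     (simp add: power2_eq_square power3_eq_cube algebra_simps)

lemma isCont_A [continuous_intros]: "isCont A x"
  by (rule DERIV_isCont[OF deriv_A])

lemma F0_of_eq: "F0_of u = (\<lambda>x. (1 + A x * h x) * M x)"
proof
  fix x
  have "deriv u x = u' x" by (rule DERIV_imp_deriv[OF deriv_u])
  \<comment> \<open>The fourth power turns the factor \<open>1 / 2\<close> in the exponent of
    \<open>E_of\<close> into 2.\<close>
  moreover have "E_of u x ^ 4 * F_GUE_of u x = M x"
    by (simp add: E_of_def F_GUE_of_def M_def v_of_eq exp_add flip: exp_of_nat_mult)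
  ultimately show "F0_of u x = (1 + A x * h x) * M x"
    by (simp add: F0_of_def v_of_eq A_def mult.assoc)
qed

text \<open>The derivative of \<open>F0_of u\<close>: the terms \<open>2 u A h\<close> cancel, and
  \<open>A (h^2 - u^2) + 2 (h - u)\<close> remains. Factoring out \<open>h - u\<close> exposes the
  exponential decay at infinity.\<close>

definition f0 :: "real \<Rightarrow> real" where
  "f0 x = (h x - u x) * (A x * (h x + u x) + 2) * M x"

lemma deriv_F0: "(F0_of u has_real_derivative f0 x) (at x)"
  unfolding F0_of_eq f0_def
  by (rule derivative_eq_intros deriv_A deriv_h deriv_M refl)+
     (simp add: power2_eq_square algebra_simps)

lemma isCont_f0 [continuous_intros]: "isCont f0 x"
  unfolding f0_def by (intro continuous_intros)

text \<open>The function \<open>A * M\<close> is a primitive of \<open>F0_of u\<close>, so integration by parts gives the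
  following primitive of \<open>x * f0 x\<close>, in which the term \<open>x * M x\<close> has cancelled.\<close>

definition P :: "real \<Rightarrow> real" where
  "P x = x * A x * h x * M x - (2 * u' x + 2 * (u x)\<^sup>2) * M x"

lemma deriv_P: "(P has_real_derivative f0 x * x) (at x)"
proof -
  have "P = (\<lambda>x. x * F0_of u x - A x * M x)"
    by (simp add: fun_eq_iff P_def F0_of_eq A_def algebra_simps)
  moreover have "((\<lambda>x. x * F0_of u x - A x * M x) has_real_derivative f0 x * x) (at x)"
    by (rule derivative_eq_intros deriv_A deriv_M deriv_F0 refl)+
       (simp add: F0_of_eq algebra_simps)
  ultimately show ?thesis by simp
qed

section \<open>Behaviour at plus infinity\<close>

lemma M_tendsto_1: "(M \<longlongrightarrow> 1) at_top"
proof -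
  have lim: "((\<lambda>x. C * exp (- x)) \<longlongrightarrow> 0) at_top" for C :: real
    by (rule tendsto_mult_right_zero) real_asymp
  have "((\<lambda>x. LBINT s:{x..}. u s) \<longlongrightarrow> 0) at_top"
  proof (rule Lim_null_comparison[OF _ lim])
    show "eventually (\<lambda>x. norm (LBINT s:{x..}. u s) \<le> K * exp (- x)) at_top"
      using eventually_ge_at_top[of 2]
      by eventually_elim (simp only: real_norm_def, rule exp_tail_bound[OF isCont_u u_exp_bound])
  qed
  moreover have "((\<lambda>x. LBINT s:{x..}. - h s) \<longlongrightarrow> 0) at_top"
  proof (rule Lim_null_comparison[OF _ lim])
    show "eventually (\<lambda>x. norm (LBINT s:{x..}. - h s) \<le> K\<^sup>2 * exp (- x)) at_top"
      using eventually_ge_at_top[of 2]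
      by eventually_elim (simp only: real_norm_def integral_h_bound)
  qed
  ultimately have "(M \<longlongrightarrow> exp (2 * 0 + 0)) at_top"
    unfolding M_def by (intro tendsto_intros)
  then show ?thesis by simp
qed

lemma bigo_at_top:
  shows "u \<in> O[at_top](\<lambda>x. exp (- x))" "h \<in> O[at_top](\<lambda>x. exp (- x))"
    and "M \<in> O[at_top](\<lambda>_. 1)" "A \<in> O[at_top](\<lambda>x. x)"
proof -
  show "u \<in> O[at_top](\<lambda>x. exp (- x))"
    by (intro bigoI[of _ K] eventually_mono[OF eventually_ge_at_top[of 2]]) (simp add: u_exp_bound)
  show "h \<in> O[at_top](\<lambda>x. exp (- x))"
    by (intro bigoI[of _ "K\<^sup>2"] eventually_mono[OF eventually_ge_at_top[of 2]]) (simp add: h_exp_bound)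
  show "M \<in> O[at_top](\<lambda>_. 1)"
    using M_tendsto_1 by (intro bigoI_tendsto[where c = 1]) auto
  have "((\<lambda>x. 2 * u' x + 2 * (u x)\<^sup>2) \<longlongrightarrow> 2 * 0 + 2 * 0\<^sup>2) at_top"
    by (intro tendsto_intros u_tendsto_0 u'_tendsto_0)
  then have "(\<lambda>x. 2 * u' x + 2 * (u x)\<^sup>2) \<in> O[at_top](\<lambda>_. 1)"
    by (intro bigoI_tendsto[where c = 0]) auto
  also have "(\<lambda>_. 1) \<in> O[at_top](\<lambda>x::real. x)" by real_asymp
  finally show "A \<in> O[at_top](\<lambda>x. x)"
    unfolding A_def add.assoc by (rule sum_in_bigo(1)[OF landau_o.big_refl])
qed

text \<open>The factor \<open>h - u\<close> is exponentially small, the other two factors of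
  \<open>f0\<close> are bounded. The rate \<open>1 / x^2\<close> is the one that
  \<open>integrable_lborel_bigo\<close> asks for.\<close>

lemma f0_bigo_at_top: "(\<lambda>x. f0 x * x) \<in> O[at_top](\<lambda>x. 1 / x\<^sup>2)"
proof -
  have "(\<lambda>x. A x * (h x + u x)) \<in> O[at_top](\<lambda>x. x * exp (- x))"
    by (intro landau_o.big.mult sum_in_bigo bigo_at_top)
  also have "(\<lambda>x. x * exp (- x)) \<in> O[at_top](\<lambda>x::real. 1)" by real_asymp
  finally have fac: "(\<lambda>x. A x * (h x + u x) + 2) \<in> O[at_top](\<lambda>x. 1)"
    by (intro sum_in_bigo) auto
  have "(\<lambda>x. f0 x * x) \<in> O[at_top](\<lambda>x. exp (- x) * 1 * 1 * x)"
    unfolding f0_def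
    by (rule landau_o.big.mult[OF landau_o.big.mult[OF landau_o.big.mult[OF
            sum_in_bigo(2)[OF bigo_at_top(2,1)] fac] bigo_at_top(3)] landau_o.big_refl])
  also have "(\<lambda>x. exp (- x) * 1 * 1 * x) \<in> O[at_top](\<lambda>x::real. 1 / x\<^sup>2)" by real_asymp
  finally show ?thesis .
qed

text \<open>The first summand is killed by the exponential decay of \<open>h\<close>. In the second,
  \<open>M\<close> tends to 1 and its cofactor to 0.\<close>

lemma P_tendsto_0_at_top: "(P \<longlongrightarrow> 0) at_top"
proof -
  have "(\<lambda>x. x * A x * h x * M x) \<in> O[at_top](\<lambda>x. x * x * exp (- x) * 1)"
    by (intro landau_o.big.mult bigo_at_top) auto
  also have "(\<lambda>x. x * x * exp (- x) * 1) \<in> o[at_top](\<lambda>x::real. 1)" by real_asymp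
  finally have "((\<lambda>x. x * A x * h x * M x) \<longlongrightarrow> 0) at_top"
    by (auto dest: smalloD_tendsto)
  then have "(P \<longlongrightarrow> 0 - (2 * 0 + 2 * 0\<^sup>2) * 1) at_top"
    unfolding P_def by (intro tendsto_intros M_tendsto_1 u_tendsto_0 u'_tendsto_0)
  then show ?thesis by simp
qed

section \<open>Behaviour at minus infinity\<close>

lemma bigo_at_bot:
  shows "u \<in> O[at_bot](\<lambda>x. x)" "u' \<in> O[at_bot](\<lambda>x. x)" "h \<in> O[at_bot](\<lambda>x. x\<^sup>2)"
    and "(\<lambda>x. (u x)\<^sup>2) \<in> O[at_bot](\<lambda>x. x)"
proof -
  \<comment> \<open>In the Hamiltonian, \<open>u^4 \<le> 16 x^2\<close> and
    \<open>h \<le> (h (- 1) + 2) x^2\<close>; 18 is \<open>16 + 2\<close>.\<close>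
  define D where "D = 18 + h (- 1)"
  have bounds: "\<bar>u x\<bar> \<le> 2 * \<bar>x\<bar>" "\<bar>u' x\<bar> \<le> D * \<bar>x\<bar>" "\<bar>h x\<bar> \<le> D * \<bar>x\<^sup>2\<bar>" "\<bar>(u x)\<^sup>2\<bar> \<le> 4 * \<bar>x\<bar>"
    if x: "x \<le> - 1" for x
  proof -
    have D: "1 \<le> D" using h_nonneg[of "- 1"] by (simp add: D_def)
    have u2: "(u x)\<^sup>2 \<le> - 4 * x" using u_squared_bound_left[OF x] .
    have x2: "- x \<le> x\<^sup>2" "1 \<le> x\<^sup>2"
      using mult_mono[of 1 "- x" 1 "- x"] mult_left_mono[of 1 "- x" "- x"] x
      by (auto simp: power2_eq_square)
    have "h (- 1) * 1 \<le> h (- 1) * x\<^sup>2" using x2 h_nonneg by (intro mult_left_mono)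
    then have h: "h x \<le> (h (- 1) + 2) * x\<^sup>2"
      using h_bound_left[OF x] by (simp add: algebra_simps)
    then show "\<bar>h x\<bar> \<le> D * \<bar>x\<^sup>2\<bar>"
      using h_nonneg[of x] x2 by (simp add: D_def algebra_simps)
    show "\<bar>(u x)\<^sup>2\<bar> \<le> 4 * \<bar>x\<bar>" using u2 x by simp
    have "(u x)\<^sup>2 \<le> (2 * x)\<^sup>2" using u2 x2 by (simp add: power_mult_distrib)
    then have "\<bar>u x\<bar> \<le> \<bar>2 * x\<bar>" by (simp only: abs_le_square_iff)
    then show "\<bar>u x\<bar> \<le> 2 * \<bar>x\<bar>" by (simp add: abs_mult)
    have "((u x)\<^sup>2)\<^sup>2 \<le> (- 4 * x)\<^sup>2" using u2 by (rule power_mono) simp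
    moreover have "x * (u x)\<^sup>2 \<le> 0" using x by (intro mult_nonpos_nonneg) auto
    ultimately have "(u' x)\<^sup>2 \<le> D * x\<^sup>2"
      unfolding u'_squared using h by (simp add: D_def algebra_simps power_mult_distrib)
    \<comment> \<open>Since \<open>D \<ge> 1\<close>, a second factor \<open>D\<close> may be
      inserted to make the bound a perfect square.\<close>
    also have "\<dots> \<le> D * (D * x\<^sup>2)" using D by (intro mult_left_mono mult_right_mono[of 1 D "x\<^sup>2", simplified]) auto
    also have "\<dots> = (D * x)\<^sup>2" by (simp add: power2_eq_square)
    finally have "\<bar>u' x\<bar> \<le> \<bar>D * x\<bar>" by (simp only: abs_le_square_iff)
    then show "\<bar>u' x\<bar> \<le> D * \<bar>x\<bar>" using D by (simp add: abs_mult)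
  qed
  note ev = eventually_le_at_bot[of "- 1 :: real"]
  show "u \<in> O[at_bot](\<lambda>x. x)"
    by (rule bigoI[of _ 2]) (use ev in eventually_elim, use bounds in simp)
  show "u' \<in> O[at_bot](\<lambda>x. x)"
    by (rule bigoI[of _ D]) (use ev in eventually_elim, use bounds in simp)
  show "h \<in> O[at_bot](\<lambda>x. x\<^sup>2)"
    by (rule bigoI[of _ D]) (use ev in eventually_elim, use bounds in simp)
  show "(\<lambda>x. (u x)\<^sup>2) \<in> O[at_bot](\<lambda>x. x)"
    by (rule bigoI[of _ 4]) (use ev in eventually_elim, use bounds in simp)
qed

lemma A_bigo_at_bot: "A \<in> O[at_bot](\<lambda>x. x)"
  unfolding A_def using bigo_at_bot by (intro sum_in_bigo) auto

text \<open>\<open>ln (M / h^2)\<close> has derivative at least \<open>h / 2\<close>, and to the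
  left of \<open>a\<close> this is at least \<open>h a / 2\<close>. Subtracting the corresponding
  linear function leaves a nondecreasing \<open>L\<close>.\<close>

lemma M_bound_left:
  assumes a: "0 < h a" and "x \<le> a"
  shows "M x \<le> M a / (h a)\<^sup>2 * exp (- (h a / 2 * a)) * ((h x)\<^sup>2 * exp (h a / 2 * x))"
proof -
  define c where "c = h a / 2"
  define L where "L = (\<lambda>x. 2 * (LBINT s:{x..}. u s) + (LBINT s:{x..}. - h s) - 2 * ln (h x) - c * x)"
  have pos: "h a \<le> h y" "0 < h y" if "y \<le> a" for y
    using h_antimono[OF that] a by auto
  have "L x \<le> L a"
  proof (rule DERIV_nonneg_imp_nondecreasing[OF \<open>x \<le> a\<close>], intro exI conjI)
    fix y assume "y \<le> a"
    note y = pos[OF this]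
    show "(L has_real_derivative h y - 2 * u y + 2 * ((u y)\<^sup>2 / h y) - c) (at y)"
      unfolding L_def using y
      by (auto intro!: derivative_eq_intros deriv_integral_u deriv_integral_h deriv_h)
    \<comment> \<open>This square is the derivative of \<open>ln (M / h^2)\<close> minus
      \<open>h / 2\<close>.\<close>
    have "0 \<le> (h y - 2 * u y)\<^sup>2 / (2 * h y)" using y by simp
    also have "\<dots> = h y / 2 - 2 * u y + 2 * ((u y)\<^sup>2 / h y)"
      using y by (simp add: field_simps power2_eq_square)
    finally show "0 \<le> h y - 2 * u y + 2 * ((u y)\<^sup>2 / h y) - c"
      using y by (simp add: c_def)
  qed
  moreover have M: "M y = exp (L y) * ((h y)\<^sup>2 * exp (c * y))" if "y \<le> a" for y
    using pos[OF that] by (simp add: M_def L_def exp_diff exp_double)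
  moreover have "exp (L a) = M a / (h a)\<^sup>2 * exp (- (c * a))"
    using M[of a] a by (simp add: exp_minus)
  ultimately show ?thesis
    using M[OF \<open>x \<le> a\<close>] by (simp add: c_def mult_right_mono)
qed

text \<open>The rate \<open>c\<close> is \<open>h a / 2\<close>; the polynomial factor comes from
  \<open>h\<^sup>2\<close> and the quadratic growth of \<open>h\<close>.\<close>

lemma M_bigo_at_bot:
  assumes "0 < h a"
  obtains c where "0 < c" "M \<in> O[at_bot](\<lambda>x. x ^ 4 * exp (c * x))"
proof
  show "0 < h a / 2" using assms by simp
  have "M \<in> O[at_bot](\<lambda>x. (h x)\<^sup>2 * exp (h a / 2 * x))"
  proof (rule bigoI)
    show "eventually (\<lambda>x. norm (M x) \<le> M a / (h a)\<^sup>2 * exp (- (h a / 2 * a)) *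
        norm ((h x)\<^sup>2 * exp (h a / 2 * x))) at_bot"
      using eventually_le_at_bot[of a]
    proof eventually_elim
      case (elim x)
      have "norm (M x) = M x" by (simp add: M_def)
      with M_bound_left[OF assms elim] show ?case by (simp add: abs_mult)
    qed
  qed
  also have "(\<lambda>x. (h x)\<^sup>2 * exp (h a / 2 * x)) \<in> O[at_bot](\<lambda>x. (x\<^sup>2)\<^sup>2 * exp (h a / 2 * x))"
    by (intro landau_o.big.mult landau_o.big_power bigo_at_bot) auto
  finally show "M \<in> O[at_bot](\<lambda>x. x ^ 4 * exp (h a / 2 * x))" by simp
qed

text \<open>All factors besides \<open>M\<close> grow at most polynomially, so the exponential rate
  of \<open>M\<close> decides.\<close>

lemma f0_bigo_at_bot:
  assumes "0 < h a"
  shows "(\<lambda>x. f0 x * x) \<in> O[at_bot](\<lambda>x. 1 / x\<^sup>2)"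
proof -
  obtain c where c: "0 < c" and M: "M \<in> O[at_bot](\<lambda>x. x ^ 4 * exp (c * x))"
    using M_bigo_at_bot[OF assms] .
  have u: "u \<in> O[at_bot](\<lambda>x. x\<^sup>2)"
    by (rule landau_o.big_trans[OF bigo_at_bot(1)]) real_asymp
  have "(\<lambda>x. A x * (h x + u x)) \<in> O[at_bot](\<lambda>x. x * x\<^sup>2)"
    by (intro landau_o.big.mult sum_in_bigo A_bigo_at_bot bigo_at_bot u)
  moreover have "(\<lambda>x. 2) \<in> O[at_bot](\<lambda>x::real. x * x\<^sup>2)" by real_asymp
  ultimately have fac: "(\<lambda>x. A x * (h x + u x) + 2) \<in> O[at_bot](\<lambda>x. x * x\<^sup>2)"
    by (rule sum_in_bigo)
  have "(\<lambda>x. f0 x * x) \<in> O[at_bot](\<lambda>x. x\<^sup>2 * (x * x\<^sup>2) * (x ^ 4 * exp (c * x)) * x)"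
    unfolding f0_def
    by (rule landau_o.big.mult[OF landau_o.big.mult[OF landau_o.big.mult[OF
            sum_in_bigo(2)[OF bigo_at_bot(3) u] fac] M] landau_o.big_refl])
  also have "(\<lambda>x. x\<^sup>2 * (x * x\<^sup>2) * (x ^ 4 * exp (c * x)) * x) \<in> O[at_bot](\<lambda>x. 1 / x\<^sup>2)"
    using c by real_asymp
  finally show ?thesis .
qed

lemma P_tendsto_0_at_bot:
  assumes "0 < h a"
  shows "(P \<longlongrightarrow> 0) at_bot"
proof -
  obtain c where c: "0 < c" and M: "M \<in> O[at_bot](\<lambda>x. x ^ 4 * exp (c * x))"
    using M_bigo_at_bot[OF assms] .
  have "(\<lambda>x. x * A x * h x * M x) \<in> O[at_bot](\<lambda>x. x * x * x\<^sup>2 * (x ^ 4 * exp (c * x)))"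
    by (intro landau_o.big.mult A_bigo_at_bot bigo_at_bot M) auto
  also have "(\<lambda>x. x * x * x\<^sup>2 * (x ^ 4 * exp (c * x))) \<in> O[at_bot](\<lambda>x. 1 / x)"
    using c by real_asymp
  finally have 1: "(\<lambda>x. x * A x * h x * M x) \<in> O[at_bot](\<lambda>x. 1 / x)" .
  have "(\<lambda>x. (2 * u' x + 2 * (u x)\<^sup>2) * M x) \<in> O[at_bot](\<lambda>x. x * (x ^ 4 * exp (c * x)))"
    using bigo_at_bot by (intro landau_o.big.mult sum_in_bigo M) auto
  also have "(\<lambda>x. x * (x ^ 4 * exp (c * x))) \<in> O[at_bot](\<lambda>x. 1 / x)"
    using c by real_asymp
  finally have "P \<in> O[at_bot](\<lambda>x. 1 / x)"
    unfolding P_def using 1 by (intro sum_in_bigo)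
  also have "(\<lambda>x. 1 / x) \<in> o[at_bot](\<lambda>x::real. 1)" by real_asymp
  finally show ?thesis by (auto dest: smalloD_tendsto)
qed

section \<open>Vanishing of the mean\<close>

lemma F0_mean_zero: "has_stieltjes_integral (\<lambda>x. x) (F0_of u) 0"
proof (rule has_stieltjes_integral_C1[OF deriv_F0 isCont_f0])
  show "has_bochner_integral lborel (\<lambda>x. f0 x * x) 0"
  proof (cases "\<exists>a. 0 < h a")
    case True
    then obtain a where a: "0 < h a" ..
    have cont: "isCont (\<lambda>x. f0 x * x) x" for x by (intro continuous_intros)
    have "has_bochner_integral lborel (\<lambda>x. f0 x * x) (0 - 0)"
      by (rule has_bochner_integral_FTC_real_line[OF deriv_P cont
            integrable_lborel_bigo[OF cont f0_bigo_at_top f0_bigo_at_bot[OF a]]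
            P_tendsto_0_at_bot[OF a] P_tendsto_0_at_top])
    then show ?thesis by simp
  next
    \<comment> \<open>The locale admits the zero solution: if \<open>h\<close> vanishes identically,
      so does \<open>u\<^sup>2 = - h'\<close>, and the density \<open>f0\<close> is 0.\<close>
    case False
    then have h0: "h = (\<lambda>_. 0)" using h_nonneg by (metis antisym not_less ext)
    have "u x = 0" for x
      using DERIV_unique[OF deriv_h[of x]] DERIV_const[of 0] unfolding h0 by fastforce
    then have "f0 x = 0" for x by (simp add: f0_def h0)
    then show ?thesis by (simp add: has_bochner_integral_zero)
  qed
qed simp

end

theorem proposition2p1:
  fixes u :: "real \<Rightarrow> real"
  assumes "painleve_II u"
    and "u \<sim>[at_top] (\<lambda>x. - Airy_Ai x)"
  shows "has_stieltjes_integral (\<lambda>x. x) (F0_of u) 0"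
proof -
  interpret decaying_painleve_II u "deriv u"
  proof
    show "(u has_real_derivative deriv u x) (at x)" for x
      using assms(1) by (simp add: painleve_II_def DERIV_deriv_iff_real_differentiable)
    show "(deriv u has_real_derivative 2 * u x ^ 3 + x * u x) (at x)" for x
      using assms(1) by (simp add: painleve_II_def)
    show "(u \<longlongrightarrow> 0) at_top"
      \<comment> \<open>Asymptotically equivalent functions share their limits, so \<open>u\<close>
        inherits the limit of \<open>- Airy_Ai\<close>.\<close>
      using tendsto_minus[OF Airy_Ai_tendsto_0] tendsto_asymp_equiv_cong[OF assms(2)] by simp
  qed
  show ?thesis by (rule F0_mean_zero)
qed

end
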